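(* Let $\gamma\in(0,2)$, let $\nu$ be a probability distribution on $\mathbb R^d$ with finite $\gamma$-th absolute moment $M_\gamma(\nu)=\int\|x\|^\gamma\,d\nu(x)$, and let $\nu_n=\frac1n\sum_{i=1}^n\delta_{X_i}$ for an i.i.d. sample $X_1,\dots,X_n$ from $\nu$. Then $$\mathbb E\,\mathcal E_\gamma^2(\nu,\nu_n)\le\frac{2M_\gamma(\nu)}n .$$
   Context: The generalized energy distance is given by $\mathcal E_\gamma^2(\mu,\nu)=\mathbb E\big[2\|X-Y\|^\gamma-\|X-X'\|^\gamma-\|Y-Y'\|^\gamma\big]$ with $(X,X',Y,Y')\sim\mu^{\otimes2}\otimes\nu^{\otimes2}$, for probability distributions $\mu,\nu$ on $\mathbb R^d$ with finite $\gamma$-th absolute moment. In $\mathbb E\,\mathcal E_\gamma^2(\nu,\nu_n)$ the outer expectation is over the sample. *)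

theory Defs
  imports "HOL-Probability.Probability"
begin

definition abs_moment :: "real \<Rightarrow> 'a::euclidean_space measure \<Rightarrow> real" where
  "abs_moment \<gamma> \<nu> = (LINT x|\<nu>. norm x powr \<gamma>)"

definition finite_abs_moment :: "real \<Rightarrow> 'a::euclidean_space measure \<Rightarrow> bool" where
  "finite_abs_moment \<gamma> \<nu> \<longleftrightarrow> integrable \<nu> (\<lambda>x. norm x powr \<gamma>)"

text \<open>
  The squared distance is meant for Borel probability measures with finite \<open>\<gamma>\<close>-th absolute
  moment. There the integrand is integrable, because \<open>norm (x - y) powr \<gamma>\<close> is at most
  \<open>2 powr \<gamma> * (norm x powr \<gamma> + norm y powr \<gamma>)\<close>, so the value \<open>0\<close> that the Bochner integral
  assigns to non-integrable functions does not occur.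
\<close>

definition energy_dist_sq ::
    "real \<Rightarrow> 'a::euclidean_space measure \<Rightarrow> 'a measure \<Rightarrow> real" where
  "energy_dist_sq \<gamma> \<mu> \<nu> =
     (LINT ((x, x'), (y, y'))|((\<mu> \<Otimes>\<^sub>M \<mu>) \<Otimes>\<^sub>M (\<nu> \<Otimes>\<^sub>M \<nu>)).
        2 * norm (x - y) powr \<gamma> - norm (x - x') powr \<gamma> - norm (y - y') powr \<gamma>)"

text \<open>Dirac measures are \<^term>\<open>return borel x\<close>. The definition is meaningful for \<open>n > 0\<close>.\<close>

definition empirical_measure :: "nat \<Rightarrow> (nat \<Rightarrow> 'a::euclidean_space) \<Rightarrow> 'a measure" where
  "empirical_measure n x =
     measure_of UNIV (sets borel)
       (\<lambda>A. ennreal (1 / real n) * (\<Sum>i=1..n. emeasure (return borel (x i)) A))"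

lemma space_empirical_measure [simp]: "space (empirical_measure n x) = UNIV"
  unfolding empirical_measure_def by (rule space_measure_of) simp

lemma sets_empirical_measure [simp, measurable_cong]:
  "sets (empirical_measure n x) = sets borel"
  unfolding empirical_measure_def
  using sets.sigma_sets_eq[of "borel :: 'a measure"] by (simp add: sets_measure_of)

lemma emeasure_empirical_measure:
  assumes "A \<in> sets borel"
  shows "emeasure (empirical_measure n x) A =
           ennreal (1 / real n) * (\<Sum>i=1..n. emeasure (return borel (x i)) A)"
proof (rule emeasure_measure_of[OF empirical_measure_def])
  show "countably_additive (sets (empirical_measure n x))
     (\<lambda>A. ennreal (1 / real n) * (\<Sum>i=1..n. emeasure (return borel (x i)) A))"
    unfolding countably_additive_def
  proof safe
    fix B :: "nat \<Rightarrow> 'a set"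
    assume B: "range B \<subseteq> sets (empirical_measure n x)" "disjoint_family B"
    have "(\<Sum>k. ennreal (1 / real n) * (\<Sum>i=1..n. emeasure (return borel (x i)) (B k))) =
      ennreal (1 / real n) * (\<Sum>i=1..n. (\<Sum>k. emeasure (return borel (x i)) (B k)))"
      by (subst ennreal_suminf_cmult, subst suminf_sum) (auto intro: summableI)
    also have "(\<Sum>i=1..n. (\<Sum>k. emeasure (return borel (x i)) (B k))) =
        (\<Sum>i=1..n. emeasure (return borel (x i)) (\<Union>k. B k))"
      using B by (intro sum.cong refl suminf_emeasure) auto
    finally show "(\<Sum>k. ennreal (1 / real n) * (\<Sum>i=1..n. emeasure (return borel (x i)) (B k))) =
      ennreal (1 / real n) * (\<Sum>i=1..n. emeasure (return borel (x i)) (\<Union>k. B k))" .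
  qed
qed (use assms in \<open>auto simp: positive_def\<close>)

lemma prob_space_empirical_measure:
  assumes "n > 0"
  shows "prob_space (empirical_measure n x)"
proof
  have "ennreal (1 / real n) * of_nat n = 1"
    using assms by (simp add: ennreal_of_nat_eq_real_of_nat flip: ennreal_mult)
  then show "emeasure (empirical_measure n x) (space (empirical_measure n x)) = 1"
    by (simp add: emeasure_empirical_measure)
qed

end

theory Submission
  imports Defs
begin

text \<open>
  Let \<open>D\<close> be the mean of \<open>norm (x - x') powr \<gamma>\<close> under \<open>\<nu> \<otimes> \<nu>\<close>. By independence, and because the
  diagonal pairs contribute \<open>0\<close>, the expected energy distance is \<open>2 D - D - (1 - 1/n) D = D / n\<close>.
  It remains to see that \<open>D\<close> is at most twice the \<open>\<gamma>\<close>-th moment, which for \<open>\<gamma> > 1\<close> does not follow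
  from the triangle inequality. Since \<open>s powr \<gamma>\<close> is, up to a positive constant, the integral of
  \<open>(1 - exp (- t s^2)) t powr (- \<gamma>/2 - 1)\<close> over \<open>t > 0\<close>, it suffices to compare the integrals of
  \<open>1 - exp (- t |x - x'|^2)\<close> and \<open>2 (1 - exp (- t |x|^2))\<close> for each \<open>t\<close>. Up to a constant,
  \<open>exp (- t |x - y|^2)\<close> is the integral over \<open>z\<close> of \<open>h (x - z) h (y - z)\<close> with
  \<open>h v = exp (- 2 t |v|^2)\<close>; so with \<open>H z\<close> the \<open>\<nu>\<close>-mean of \<open>h (x - z)\<close>, the comparison reads
  \<open>2 \<integral> H h \<le> \<integral> H^2 + \<integral> h^2\<close>.
\<close>

section \<open>Gaussian integrals and the convolution identity\<close>

text \<open>The integral factors over the coordinates into one-dimensional normal integrals. It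
  later appears as a common factor on both sides of an \<open>ennreal\<close> inequality, and these
  two facts are what cancelling it requires.\<close>

lemma nn_integral_gaussian:
  fixes a :: real
  assumes "0 < a"
  defines "I \<equiv> (\<integral>\<^sup>+z. ennreal (exp (- a * (norm (z :: 'a::euclidean_space))\<^sup>2)) \<partial>lborel)"
  shows "I \<noteq> 0" and "I \<noteq> \<top>"
proof -
  \<comment> \<open>Chosen so that \<open>exp (- a * s\<^sup>2)\<close> is an unnormalised normal
    density with standard deviation \<open>\<sigma>\<close>; its normalising factor \<open>J\<close>
    is then the square root of \<open>pi / a\<close>.\<close>
  define \<sigma> where "\<sigma> = sqrt (1 / (2 * a))"
  have \<sigma>: "0 < \<sigma>" "2 * \<sigma>\<^sup>2 = 1 / a"
    using assms(1) by (auto simp: \<sigma>_def)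
  define J where "J = sqrt (2 * pi * \<sigma>\<^sup>2)"
  have "0 < J" using \<sigma> by (simp add: J_def)
  have exp_eq: "exp (- a * s\<^sup>2) = J * normal_density 0 \<sigma> s" for s
    using \<sigma> \<open>0 < J\<close> assms(1) by (simp add: normal_density_def J_def[symmetric])
  have one_dim: "(\<integral>\<^sup>+s. ennreal (exp (- a * s\<^sup>2)) \<partial>lborel) = ennreal J"
    unfolding exp_eq using \<sigma> \<open>0 < J\<close>
    by (simp add: ennreal_mult nn_integral_cmult nn_integral_eq_integral)
  have norm_sq: "(norm z)\<^sup>2 = (\<Sum>b\<in>Basis. (z \<bullet> b)\<^sup>2)" for z :: 'a
    unfolding power2_norm_eq_inner by (subst euclidean_inner) (simp add: power2_eq_square)
  have "I = (\<integral>\<^sup>+z. (\<Prod>b\<in>Basis. ennreal (exp (- a * ((z::'a) \<bullet> b)\<^sup>2))) \<partial>lborel)"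
    unfolding I_def norm_sq by (simp add: prod_ennreal exp_sum sum_distrib_left flip: sum_negf)
  also have "\<dots> = (\<Prod>b\<in>(Basis :: 'a set). ennreal J)"
    by (subst nn_integral_lborel_prod) (auto simp del: prod_constant simp: one_dim[simplified])
  finally have "I = ennreal (J ^ DIM('a))"
    using \<open>0 < J\<close> by (simp add: ennreal_power)
  then show "I \<noteq> 0" "I \<noteq> \<top>"
    using \<open>0 < J\<close> by auto
qed

lemma nn_integral_lborel_translate:
  fixes f :: "'a::euclidean_space \<Rightarrow> ennreal"
  assumes [measurable]: "f \<in> borel_measurable borel"
  shows "(\<integral>\<^sup>+z. f (z - c) \<partial>lborel) = (\<integral>\<^sup>+z. f z \<partial>lborel)"
  by (subst lborel_distr_plus[of c, symmetric], subst nn_integral_distr) simp_all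

text \<open>Completing the square around the midpoint of \<open>x\<close> and \<open>y\<close>
  separates the exponent into a part depending on \<open>z\<close> and a part depending on
  \<open>x - y\<close>. Translation invariance then removes the midpoint from the integral.\<close>

lemma gaussian_convolution:
  fixes x y :: "'a::euclidean_space" and t :: real
  shows "(\<integral>\<^sup>+z. ennreal (exp (- (2 * t) * (norm (x - z))\<^sup>2)) *
                ennreal (exp (- (2 * t) * (norm (y - z))\<^sup>2)) \<partial>lborel) =
         (\<integral>\<^sup>+z. ennreal (exp (- (4 * t) * (norm (z::'a))\<^sup>2)) \<partial>lborel) *
           ennreal (exp (- t * (norm (x - y))\<^sup>2))"
proof -
  define m where "m = (1 / 2) *\<^sub>R (x + y)"
  \<comment> \<open>The parallelogram law for \<open>x - z\<close> and \<open>y - z\<close>, whose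
    sum is twice \<open>m - z\<close>.\<close>
  have split: "2 * (norm (x - z))\<^sup>2 + 2 * (norm (y - z))\<^sup>2 = (norm (x - y))\<^sup>2 + 4 * (norm (z - m))\<^sup>2"
    for z
    by (simp add: m_def power2_norm_eq_inner algebra_simps inner_commute)
  have "- (2 * t) * (norm (x - z))\<^sup>2 + - (2 * t) * (norm (y - z))\<^sup>2 =
      - (4 * t) * (norm (z - m))\<^sup>2 + - t * (norm (x - y))\<^sup>2" for z
    using arg_cong[OF split[of z], of "\<lambda>u. - t * u"] by (simp add: algebra_simps)
  then have "ennreal (exp (- (2 * t) * (norm (x - z))\<^sup>2)) * ennreal (exp (- (2 * t) * (norm (y - z))\<^sup>2)) =
      ennreal (exp (- (4 * t) * (norm (z - m))\<^sup>2)) * ennreal (exp (- t * (norm (x - y))\<^sup>2))" for z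
    by (simp only: ennreal_mult'[symmetric] exp_ge_zero exp_add[symmetric])
  then show ?thesis
    using nn_integral_lborel_translate[of "\<lambda>z. ennreal (exp (- (4 * t) * (norm z)\<^sup>2))" m]
    by (simp add: nn_integral_multc)
qed

section \<open>Comparison of Gaussian kernel means\<close>

text \<open>Subtraction in \<open>ennreal\<close> is truncated, so the square of
  \<open>a - b\<close> is expanded over the reals; if either argument is infinite, so is the
  right-hand side.\<close>

lemma two_mult_le_sum_squares_ennreal:
  fixes a b :: ennreal
  shows "2 * (a * b) \<le> a * a + b * b"
proof (cases a; cases b)
  fix r s :: real
  assume "0 \<le> r" "a = ennreal r" "0 \<le> s" "b = ennreal s"
  then show ?thesis
    using sum_squares_bound[of r s] ennreal_numeral[of "num.Bit0 num.One"]
    by (simp add: power2_eq_square mult.assoc flip: ennreal_mult ennreal_plus ennreal_numeral)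
qed auto

text \<open>Positive definiteness of the Gaussian kernel, applied to the signed measure \<nu> minus
  the Dirac mass at 0. The summand 1 is the kernel at the pair (0, 0).\<close>

lemma gaussian_kernel_energy_nonneg:
  fixes \<nu> :: "'a::euclidean_space measure"
  assumes "prob_space \<nu>" and [measurable_cong]: "sets \<nu> = sets borel" and "0 < t"
  shows "2 * (\<integral>\<^sup>+x. ennreal (exp (- t * (norm x)\<^sup>2)) \<partial>\<nu>)
       \<le> (\<integral>\<^sup>+x. \<integral>\<^sup>+y. ennreal (exp (- t * (norm (x - y))\<^sup>2)) \<partial>\<nu> \<partial>\<nu>) + 1"
proof -
  interpret prob_space \<nu> by fact
  interpret L: pair_sigma_finite \<nu> "lborel :: 'a measure" ..
  define e where "e x = ennreal (exp (- t * (norm x)\<^sup>2))" for x :: 'a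
  define h where "h x = ennreal (exp (- (2 * t) * (norm x)\<^sup>2))" for x :: 'a
  define K where "K = (\<integral>\<^sup>+z. ennreal (exp (- (4 * t) * (norm (z::'a))\<^sup>2)) \<partial>lborel)"
  define H where "H z = (\<integral>\<^sup>+x. h (x - z) \<partial>\<nu>)" for z
  have [measurable]: "e \<in> borel_measurable borel" "h \<in> borel_measurable borel"
    unfolding e_def[abs_def] h_def[abs_def] by measurable
  have [measurable]: "H \<in> borel_measurable borel"
    unfolding H_def[abs_def] by measurable
  have K: "K \<noteq> 0" "K \<noteq> \<top>"
    using nn_integral_gaussian[of "4 * t", where 'a='a] assms by (auto simp: K_def)
  have conv: "K * e (x - y) = (\<integral>\<^sup>+z. h (x - z) * h (y - z) \<partial>lborel)" for x y
    using gaussian_convolution[of t x y] by (simp add: e_def h_def K_def)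
  \<comment> \<open>Two applications of Tonelli's theorem move the \<open>z\<close>-integral
    outermost, where the integrals over \<open>x\<close> and \<open>y\<close> factor into two copies
    of \<open>H z\<close>.\<close>
  have two: "K * (\<integral>\<^sup>+x. \<integral>\<^sup>+y. e (x - y) \<partial>\<nu> \<partial>\<nu>) = (\<integral>\<^sup>+z. H z * H z \<partial>lborel)"
  proof -
    have "K * (\<integral>\<^sup>+x. \<integral>\<^sup>+y. e (x - y) \<partial>\<nu> \<partial>\<nu>) =
        (\<integral>\<^sup>+x. \<integral>\<^sup>+y. \<integral>\<^sup>+z. h (x - z) * h (y - z) \<partial>lborel \<partial>\<nu> \<partial>\<nu>)"
      by (simp add: nn_integral_cmult[symmetric] conv)
    also have "\<dots> = (\<integral>\<^sup>+x. \<integral>\<^sup>+z. h (x - z) * H z \<partial>lborel \<partial>\<nu>)"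
      unfolding H_def by (subst L.Fubini'[symmetric]) (simp_all add: nn_integral_cmult)
    also have "\<dots> = (\<integral>\<^sup>+z. H z * H z \<partial>lborel)"
      by (subst L.Fubini'[symmetric]) (simp_all add: nn_integral_multc H_def[symmetric])
    finally show ?thesis .
  qed
  have one: "K * (\<integral>\<^sup>+x. e x \<partial>\<nu>) = (\<integral>\<^sup>+z. H z * h (0 - z) \<partial>lborel)"
  proof -
    have "K * (\<integral>\<^sup>+x. e x \<partial>\<nu>) = (\<integral>\<^sup>+x. \<integral>\<^sup>+z. h (x - z) * h (0 - z) \<partial>lborel \<partial>\<nu>)"
      using conv[of _ 0] by (simp add: nn_integral_cmult[symmetric])
    also have "\<dots> = (\<integral>\<^sup>+z. H z * h (0 - z) \<partial>lborel)"
      by (subst L.Fubini'[symmetric]) (simp_all add: nn_integral_multc H_def[symmetric])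
    finally show ?thesis .
  qed
  have "K * (2 * (\<integral>\<^sup>+x. e x \<partial>\<nu>)) = (\<integral>\<^sup>+z. 2 * (H z * h (0 - z)) \<partial>lborel)"
    by (subst nn_integral_cmult) (simp_all only: one[symmetric] mult.left_commute, measurable)
  also have "\<dots> \<le> (\<integral>\<^sup>+z. H z * H z + h (0 - z) * h (0 - z) \<partial>lborel)"
    by (intro nn_integral_mono two_mult_le_sum_squares_ennreal)
  \<comment> \<open>The integral of the squared \<open>h\<close> is the convolution identity with
    both points at the origin.\<close>
  also have "\<dots> = (\<integral>\<^sup>+z. H z * H z \<partial>lborel) + K * e (0 - 0)"
    unfolding conv by (rule nn_integral_add) simp_all
  also have "\<dots> = K * ((\<integral>\<^sup>+x. \<integral>\<^sup>+y. e (x - y) \<partial>\<nu> \<partial>\<nu>) + 1)"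
    by (simp add: two[symmetric] distrib_left e_def)
  finally show ?thesis
    using K by (simp add: ennreal_mult_le_mult_iff e_def)
qed

text \<open>Since \<nu> has mass 1, passing to complements turns \<open>2 * A \<le> B + 1\<close>
  into \<open>1 - B \<le> 2 * (1 - A)\<close>. The complement vanishes to first order at
  \<open>t = 0\<close>, which compensates the singularity of the mixing weight there.\<close>

lemma gaussian_complement_energy:
  fixes \<nu> :: "'a::euclidean_space measure"
  assumes "prob_space \<nu>" and [measurable_cong]: "sets \<nu> = sets borel" and "0 < t"
  shows "(\<integral>\<^sup>+x. \<integral>\<^sup>+y. ennreal (1 - exp (- t * (norm (x - y))\<^sup>2)) \<partial>\<nu> \<partial>\<nu>)
       \<le> 2 * (\<integral>\<^sup>+x. ennreal (1 - exp (- t * (norm x)\<^sup>2)) \<partial>\<nu>)"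
proof -
  interpret prob_space \<nu> by fact
  define A where "A = (\<integral>\<^sup>+x. ennreal (exp (- t * (norm x)\<^sup>2)) \<partial>\<nu>)"
  define A' where "A' = (\<integral>\<^sup>+x. ennreal (1 - exp (- t * (norm x)\<^sup>2)) \<partial>\<nu>)"
  define B where "B = (\<integral>\<^sup>+x. \<integral>\<^sup>+y. ennreal (exp (- t * (norm (x - y))\<^sup>2)) \<partial>\<nu> \<partial>\<nu>)"
  define B' where "B' = (\<integral>\<^sup>+x. \<integral>\<^sup>+y. ennreal (1 - exp (- t * (norm (x - y))\<^sup>2)) \<partial>\<nu> \<partial>\<nu>)"
  have le1: "exp (- (t * (norm u)\<^sup>2)) \<le> 1" for u :: 'a
    using assms(3) by simp
  have "A + A' = (\<integral>\<^sup>+x. 1 \<partial>\<nu>)"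
    unfolding A_def A'_def using le1
    by (subst nn_integral_add[symmetric]) (simp_all flip: ennreal_plus)
  then have A: "A + A' = 1" by (simp add: emeasure_space_1)
  have "B + B' = (\<integral>\<^sup>+x. \<integral>\<^sup>+y. 1 \<partial>\<nu> \<partial>\<nu>)"
    unfolding B_def B'_def using le1
    by (simp add: nn_integral_add[symmetric] flip: ennreal_plus)
  then have B: "B + B' = 1" by (simp add: emeasure_space_1)
  have "2 * A \<le> B + 1"
    unfolding A_def B_def by (rule gaussian_kernel_energy_nonneg) fact+
  \<comment> \<open>All four integrals are finite because they sum in pairs to 1; the rearrangement
    can therefore be done over the reals.\<close>
  moreover obtain a a' b b' where
    "0 \<le> a" "A = ennreal a" "0 \<le> a'" "A' = ennreal a'"
    "0 \<le> b" "B = ennreal b" "0 \<le> b'" "B' = ennreal b'"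
    using A B by (cases A; cases A'; cases B; cases B') (auto simp: top_add add_top)
  ultimately have "B' \<le> 2 * A'"
    using A B
    by (auto simp: ennreal_mult[symmetric] simp flip: ennreal_plus ennreal_numeral ennreal_1)
  then show ?thesis by (simp add: A'_def B'_def)
qed

section \<open>Powers of the norm as Gaussian mixtures\<close>

definition mixing_weight :: "real \<Rightarrow> real \<Rightarrow> ennreal" where
  "mixing_weight \<gamma> t = ennreal (indicator {0<..} t * t powr (- \<gamma> / 2 - 1))"

text \<open>For \<gamma> strictly between 0 and 2 this is \<open>2 / \<gamma>\<close> times the
  Gamma function at \<open>1 - \<gamma> / 2\<close>, by integration by parts.\<close>

definition mixing_constant :: "real \<Rightarrow> ennreal" where
  "mixing_constant \<gamma> = (\<integral>\<^sup>+t. mixing_weight \<gamma> t * ennreal (1 - exp (- t)) \<partial>lborel)"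

lemma borel_measurable_mixing_weight [measurable]: "mixing_weight \<gamma> \<in> borel_measurable borel"
  unfolding mixing_weight_def[abs_def] by measurable

lemma mixing_constant_nonzero: "mixing_constant \<gamma> \<noteq> 0"
proof -
  \<comment> \<open>A lower bound for the integrand on the interval from 1 to 2; the absolute value
    makes the bound on the power valid for either sign of \<gamma>.\<close>
  define k where "k = 2 powr - (\<bar>\<gamma>\<bar> / 2 + 1) * (1 - exp (-1 :: real))"
  have "0 < k" by (simp add: k_def)
  have "ennreal k * indicator {1..2} t \<le> mixing_weight \<gamma> t * ennreal (1 - exp (- t))" for t
  proof (cases "t \<in> {1..2}")
    case True
    have "2 powr - (\<bar>\<gamma>\<bar> / 2 + 1) \<le> t powr - (\<bar>\<gamma>\<bar> / 2 + 1)"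
      using True by (intro powr_mono2') auto
    also have "\<dots> \<le> t powr (- \<gamma> / 2 - 1)"
      using True by (intro powr_mono) auto
    finally have "k \<le> t powr (- \<gamma> / 2 - 1) * (1 - exp (- t))"
      unfolding k_def using True by (intro mult_mono) auto
    then show ?thesis
      using True by (simp add: mixing_weight_def ennreal_leI flip: ennreal_mult)
  qed simp
  then have "(\<integral>\<^sup>+t. ennreal k * indicator {1..2::real} t \<partial>lborel) \<le> mixing_constant \<gamma>"
    unfolding mixing_constant_def by (rule nn_integral_mono)
  moreover have "(\<integral>\<^sup>+t. ennreal k * indicator {1..2::real} t \<partial>lborel) = ennreal k"
    by (simp add: nn_integral_cmult)
  ultimately show ?thesis
    using \<open>0 < k\<close> by auto
qed

text \<open>Near 0, the bound \<open>1 - exp (- t) \<le> t\<close> leaves the exponent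
  \<open>- \<gamma> / 2\<close>, integrable because \<gamma> < 2. Near infinity, the bound by 1
  leaves \<open>- \<gamma> / 2 - 1\<close>, integrable because \<gamma> > 0.\<close>

lemma mixing_constant_finite:
  assumes "0 < \<gamma>" and "\<gamma> < 2"
  shows "mixing_constant \<gamma> \<noteq> \<top>"
proof -
  define f g :: "real \<Rightarrow> real"
    where "f t = (if t \<in> {0..1} then t powr (- \<gamma> / 2) else 0)"
      and "g t = (if t \<in> {1..} then t powr (- \<gamma> / 2 - 1) else 0)" for t
  have [measurable]: "f \<in> borel_measurable borel" "g \<in> borel_measurable borel"
    unfolding f_def[abs_def] g_def[abs_def] by measurable
  have "(f has_integral (1 powr (- \<gamma> / 2 + 1) / (- \<gamma> / 2 + 1))) UNIV"
    unfolding f_def[abs_def] has_integral_restrict_UNIV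
    using assms by (intro has_integral_powr_from_0) auto
  then have f: "(\<integral>\<^sup>+t. ennreal (f t) \<partial>lborel) < \<top>"
    by (subst nn_integral_has_integral_lborel) (auto simp: f_def[abs_def])
  have "(g has_integral (- (1 powr (- \<gamma> / 2 - 1 + 1)) / (- \<gamma> / 2 - 1 + 1))) UNIV"
    unfolding g_def[abs_def] has_integral_restrict_UNIV
    using assms by (intro has_integral_powr_to_inf) auto
  then have g: "(\<integral>\<^sup>+t. ennreal (g t) \<partial>lborel) < \<top>"
    by (subst nn_integral_has_integral_lborel) (auto simp: g_def[abs_def])
  have le: "mixing_weight \<gamma> t * ennreal (1 - exp (- t)) \<le> ennreal (f t) + ennreal (g t)" for t
  proof (cases "0 < t")
    case t: True
    have "t powr (- \<gamma> / 2 - 1) * (1 - exp (- t)) \<le> f t + g t"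
    proof (cases "t \<le> 1")
      case True
      have "1 - exp (- t) \<le> t" using exp_ge_add_one_self[of "- t"] by simp
      then have "t powr (- \<gamma> / 2 - 1) * (1 - exp (- t)) \<le> t powr (- \<gamma> / 2 - 1) * t"
        by (intro mult_left_mono) auto
      also have "\<dots> = t powr (- \<gamma> / 2)"
        using t powr_mult_base[of t "- \<gamma> / 2 - 1"] by (simp add: mult.commute)
      finally show ?thesis
        using t True by (simp add: f_def g_def add_increasing2)
    next
      case False
      then show ?thesis
        by (simp add: f_def g_def mult_left_le)
    qed
    moreover have "0 \<le> f t" "0 \<le> g t" by (simp_all add: f_def g_def)
    ultimately show ?thesis
      using t by (simp add: mixing_weight_def ennreal_leI flip: ennreal_mult ennreal_plus)
  qed (simp add: mixing_weight_def)
  have "mixing_constant \<gamma> \<le> (\<integral>\<^sup>+t. ennreal (f t) \<partial>lborel) + (\<integral>\<^sup>+t. ennreal (g t) \<partial>lborel)"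
    unfolding mixing_constant_def
    by (subst nn_integral_add[symmetric]) (auto intro: nn_integral_mono le)
  also have "\<dots> < \<top>" using f g by simp
  finally show ?thesis by simp
qed

text \<open>Substitute \<open>s\<^sup>2 * t\<close> for \<open>t\<close> in the mixing constant: the
  weight contributes \<open>s powr (- \<gamma> - 2)\<close> and the Jacobian
  \<open>s\<^sup>2\<close>, together \<open>s powr - \<gamma>\<close>.\<close>

lemma powr_eq_gaussian_mixture:
  fixes s \<gamma> :: real
  assumes "0 \<le> s"
  shows "(\<integral>\<^sup>+t. mixing_weight \<gamma> t * ennreal (1 - exp (- t * s\<^sup>2)) \<partial>lborel)
       = mixing_constant \<gamma> * ennreal (s powr \<gamma>)"
\<comment> \<open>At \<open>s = 0\<close> both sides vanish, since \<open>0 powr \<gamma>\<close> is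
  0.\<close>
proof (cases "s = 0")
  case False
  then have s: "0 < s" using assms by simp
  let ?L = "\<integral>\<^sup>+t. mixing_weight \<gamma> t * ennreal (1 - exp (- t * s\<^sup>2)) \<partial>lborel"
  have s2: "s\<^sup>2 = s powr 2" using s by (simp add: powr_numeral)
  have scale: "mixing_weight \<gamma> (s\<^sup>2 * t) = ennreal (s powr (- \<gamma> - 2)) * mixing_weight \<gamma> t" for t
  proof (cases "0 < t")
    case True
    have "(s\<^sup>2) powr (- \<gamma> / 2 - 1) = s powr (- \<gamma> - 2)"
      unfolding s2 powr_powr by (simp add: algebra_simps)
    then have "(s\<^sup>2 * t) powr (- \<gamma> / 2 - 1) = s powr (- \<gamma> - 2) * t powr (- \<gamma> / 2 - 1)"
      using True s by (simp add: powr_mult)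
    then show ?thesis
      using True s by (simp add: mixing_weight_def ennreal_mult)
  qed (simp add: mixing_weight_def zero_less_mult_iff)
  have "mixing_constant \<gamma> =
      ennreal \<bar>s\<^sup>2\<bar> * (\<integral>\<^sup>+t. mixing_weight \<gamma> (0 + s\<^sup>2 * t) * ennreal (1 - exp (- (0 + s\<^sup>2 * t))) \<partial>lborel)"
    unfolding mixing_constant_def using s by (intro nn_integral_real_affine) auto
  also have "\<dots> = ennreal (s\<^sup>2) * (ennreal (s powr (- \<gamma> - 2)) * ?L)"
    by (simp add: scale mult.assoc nn_integral_cmult mult.commute[of _ "s\<^sup>2"])
  also have "\<dots> = ennreal (s powr - \<gamma>) * ?L"
    unfolding s2 by (simp add: powr_add[symmetric] flip: ennreal_mult mult.assoc)
  finally have "mixing_constant \<gamma> * ennreal (s powr \<gamma>) = ennreal (s powr \<gamma>) * ennreal (s powr - \<gamma>) * ?L"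
    by (simp add: ac_simps)
  also have "ennreal (s powr \<gamma>) * ennreal (s powr - \<gamma>) = 1"
    using s by (simp add: powr_add[symmetric] flip: ennreal_mult)
  finally show ?thesis by simp
qed simp

text \<open>After multiplication by the mixing constant, both sides are mixtures over
  \<open>t\<close> of Gaussian complements, which compare pointwise for \<open>t > 0\<close>; the
  weight is 0 elsewhere. The range of \<gamma> makes the constant finite, so that it can be
  cancelled.\<close>

lemma nn_integral_dist_powr_le:
  fixes \<nu> :: "'a::euclidean_space measure"
  assumes "prob_space \<nu>" and [measurable_cong]: "sets \<nu> = sets borel"
    and "0 < \<gamma>" and "\<gamma> < 2"
  shows "(\<integral>\<^sup>+x. \<integral>\<^sup>+y. ennreal (norm (x - y) powr \<gamma>) \<partial>\<nu> \<partial>\<nu>)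
       \<le> 2 * (\<integral>\<^sup>+x. ennreal (norm x powr \<gamma>) \<partial>\<nu>)"
proof -
  interpret prob_space \<nu> by fact
  interpret L: pair_sigma_finite \<nu> "lborel :: real measure" ..
  let ?w = "mixing_weight \<gamma>" and ?c = "mixing_constant \<gamma>"
  define q where "q t v = ennreal (1 - exp (- t * (norm v)\<^sup>2))" for t and v :: 'a
  have [measurable]: "case_prod q \<in> borel_measurable (borel \<Otimes>\<^sub>M borel)"
    unfolding q_def[abs_def] by measurable
  have mix: "?c * ennreal (norm v powr \<gamma>) = (\<integral>\<^sup>+t. ?w t * q t v \<partial>lborel)" for v
    using powr_eq_gaussian_mixture[of "norm v" \<gamma>] by (simp add: q_def)
  have "?c * (\<integral>\<^sup>+x. \<integral>\<^sup>+y. ennreal (norm (x - y) powr \<gamma>) \<partial>\<nu> \<partial>\<nu>) =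
      (\<integral>\<^sup>+x. \<integral>\<^sup>+y. \<integral>\<^sup>+t. ?w t * q t (x - y) \<partial>lborel \<partial>\<nu> \<partial>\<nu>)"
    by (simp add: nn_integral_cmult[symmetric] mix)
  also have "\<dots> = (\<integral>\<^sup>+x. \<integral>\<^sup>+t. ?w t * (\<integral>\<^sup>+y. q t (x - y) \<partial>\<nu>) \<partial>lborel \<partial>\<nu>)"
    by (subst L.Fubini'[symmetric]) (simp_all add: nn_integral_cmult)
  also have "\<dots> = (\<integral>\<^sup>+t. ?w t * (\<integral>\<^sup>+x. \<integral>\<^sup>+y. q t (x - y) \<partial>\<nu> \<partial>\<nu>) \<partial>lborel)"
    by (subst L.Fubini'[symmetric]) (simp_all add: nn_integral_cmult)
  also have "\<dots> \<le> (\<integral>\<^sup>+t. ?w t * (2 * (\<integral>\<^sup>+x. q t x \<partial>\<nu>)) \<partial>lborel)"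
  proof (rule nn_integral_mono)
    fix t
    show "?w t * (\<integral>\<^sup>+x. \<integral>\<^sup>+y. q t (x - y) \<partial>\<nu> \<partial>\<nu>) \<le> ?w t * (2 * (\<integral>\<^sup>+x. q t x \<partial>\<nu>))"
    proof (cases "0 < t")
      case True
      then show ?thesis
        unfolding q_def using assms by (intro mult_left_mono gaussian_complement_energy) auto
    qed (simp add: mixing_weight_def)
  qed
  also have "\<dots> = 2 * (\<integral>\<^sup>+t. \<integral>\<^sup>+x. ?w t * q t x \<partial>\<nu> \<partial>lborel)"
    by (simp add: nn_integral_cmult mult.left_commute[of _ 2])
  also have "\<dots> = 2 * (\<integral>\<^sup>+x. \<integral>\<^sup>+t. ?w t * q t x \<partial>lborel \<partial>\<nu>)"
    by (subst L.Fubini') simp_all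
  also have "\<dots> = ?c * (2 * (\<integral>\<^sup>+x. ennreal (norm x powr \<gamma>) \<partial>\<nu>))"
    by (simp add: mix[symmetric] nn_integral_cmult mult.left_commute)
  finally show ?thesis
    using mixing_constant_nonzero mixing_constant_finite[OF assms(3,4)]
    by (simp add: ennreal_mult_le_mult_iff)
qed

section \<open>The energy distance as a combination of mean distances\<close>

lemma distr_pair_snd:
  assumes "prob_space M" and "prob_space N"
  shows "distr (M \<Otimes>\<^sub>M N) N snd = N"
proof -
  interpret M: prob_space M by fact
  interpret N: prob_space N by fact
  interpret pair_sigma_finite M N ..
  have "distr (M \<Otimes>\<^sub>M N) N snd = distr (N \<Otimes>\<^sub>M M) N (snd \<circ> (\<lambda>(x, y). (y, x)))"
    by (subst distr_pair_swap, subst distr_distr) simp_all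
  also have "snd \<circ> (\<lambda>(x, y). (y, x)) = (fst :: 'b \<times> 'a \<Rightarrow> 'b)"
    by (simp add: fun_eq_iff)
  finally show ?thesis by (simp add: M.distr_pair_fst)
qed

text \<open>The triangle inequality bounds the distance by twice the larger norm, and the power of a
  maximum is at most the sum of the powers. This supplies the integrable majorant for mean
  distances.\<close>

lemma norm_diff_powr_le:
  fixes x y :: "'a::real_normed_vector"
  assumes "0 \<le> \<gamma>"
  shows "norm (x - y) powr \<gamma> \<le> 2 powr \<gamma> * (norm x powr \<gamma> + norm y powr \<gamma>)"
proof -
  have "norm (x - y) \<le> 2 * max (norm x) (norm y)"
    using norm_triangle_ineq4[of x y] by simp
  then have "norm (x - y) powr \<gamma> \<le> (2 * max (norm x) (norm y)) powr \<gamma>"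
    using assms by (intro powr_mono2) auto
  also have "\<dots> = 2 powr \<gamma> * max (norm x) (norm y) powr \<gamma>"
    by (simp add: powr_mult)
  also have "\<dots> \<le> 2 powr \<gamma> * (norm x powr \<gamma> + norm y powr \<gamma>)"
    by (intro mult_left_mono) (auto simp: max_def)
  finally show ?thesis .
qed

definition mean_dist_powr :: "real \<Rightarrow> 'a::euclidean_space measure \<Rightarrow> 'a measure \<Rightarrow> real" where
  "mean_dist_powr \<gamma> \<mu> \<eta> = (LINT z|(\<mu> \<Otimes>\<^sub>M \<eta>). norm (fst z - snd z) powr \<gamma>)"

lemma integrable_dist_powr:
  fixes \<mu> \<eta> :: "'a::euclidean_space measure"
  assumes "prob_space \<mu>" and [measurable_cong]: "sets \<mu> = sets borel"
    and "prob_space \<eta>" and [measurable_cong]: "sets \<eta> = sets borel"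
    and "finite_abs_moment \<gamma> \<mu>" and "finite_abs_moment \<gamma> \<eta>" and "0 \<le> \<gamma>"
  shows "integrable (\<mu> \<Otimes>\<^sub>M \<eta>) (\<lambda>z. norm (fst z - snd z) powr \<gamma>)"
proof (rule Bochner_Integration.integrable_bound)
  have "integrable (distr (\<mu> \<Otimes>\<^sub>M \<eta>) \<mu> fst) (\<lambda>x. norm x powr \<gamma>)"
    "integrable (distr (\<mu> \<Otimes>\<^sub>M \<eta>) \<eta> snd) (\<lambda>x. norm x powr \<gamma>)"
    using assms by (simp_all add: prob_space.distr_pair_fst distr_pair_snd finite_abs_moment_def)
  then have "integrable (\<mu> \<Otimes>\<^sub>M \<eta>) (\<lambda>z. norm (fst z) powr \<gamma>)"
    "integrable (\<mu> \<Otimes>\<^sub>M \<eta>) (\<lambda>z. norm (snd z) powr \<gamma>)"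
    by (simp_all add: integrable_distr_eq)
  then show "integrable (\<mu> \<Otimes>\<^sub>M \<eta>)
      (\<lambda>z. 2 powr \<gamma> * (norm (fst z) powr \<gamma> + norm (snd z) powr \<gamma>))"
    by simp
  show "AE z in \<mu> \<Otimes>\<^sub>M \<eta>. norm (norm (fst z - snd z) powr \<gamma>)
      \<le> norm (2 powr \<gamma> * (norm (fst z) powr \<gamma> + norm (snd z) powr \<gamma>))"
    using norm_diff_powr_le[OF assms(7)] by (intro AE_I2) simp
qed simp

text \<open>Each of the three terms depends only on a two-dimensional marginal of the fourfold
  product. The finite moments make each term integrable, so the Bochner integral splits.\<close>

lemma energy_dist_sq_eq:
  fixes \<mu> \<eta> :: "'a::euclidean_space measure"
  assumes "prob_space \<mu>" and [measurable_cong]: "sets \<mu> = sets borel"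
    and "prob_space \<eta>" and [measurable_cong]: "sets \<eta> = sets borel"
    and "finite_abs_moment \<gamma> \<mu>" and "finite_abs_moment \<gamma> \<eta>" and "0 \<le> \<gamma>"
  shows "energy_dist_sq \<gamma> \<mu> \<eta> =
    2 * mean_dist_powr \<gamma> \<mu> \<eta> - mean_dist_powr \<gamma> \<mu> \<mu> - mean_dist_powr \<gamma> \<eta> \<eta>"
proof -
  interpret \<mu>: prob_space \<mu> by fact
  interpret \<eta>: prob_space \<eta> by fact
  interpret \<mu>2: pair_prob_space \<mu> \<mu> ..
  interpret \<eta>2: pair_prob_space \<eta> \<eta> ..
  define Q where "Q = (\<mu> \<Otimes>\<^sub>M \<mu>) \<Otimes>\<^sub>M (\<eta> \<Otimes>\<^sub>M \<eta>)"
  define k where "k z = norm (fst z - snd z) powr \<gamma>" for z :: "'a \<times> 'a"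
  \<comment> \<open>Selects the first point of each pair, the X and Y of the cross term.\<close>
  define proj :: "('a \<times> 'a) \<times> ('a \<times> 'a) \<Rightarrow> 'a \<times> 'a" where "proj = (\<lambda>(p, q). (fst p, fst q))"
  have [measurable]: "k \<in> borel_measurable (borel \<Otimes>\<^sub>M borel)"
    unfolding k_def[abs_def] by measurable
  have [measurable]: "proj \<in> measurable Q (\<mu> \<Otimes>\<^sub>M \<eta>)" "fst \<in> measurable Q (\<mu> \<Otimes>\<^sub>M \<mu>)"
    "snd \<in> measurable Q (\<eta> \<Otimes>\<^sub>M \<eta>)"
    unfolding Q_def proj_def by measurable
  have marginals: "distr Q (\<mu> \<Otimes>\<^sub>M \<eta>) proj = \<mu> \<Otimes>\<^sub>M \<eta>"
    "distr Q (\<mu> \<Otimes>\<^sub>M \<mu>) fst = \<mu> \<Otimes>\<^sub>M \<mu>" "distr Q (\<eta> \<Otimes>\<^sub>M \<eta>) snd = \<eta> \<Otimes>\<^sub>M \<eta>"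
  proof -
    show "distr Q (\<mu> \<Otimes>\<^sub>M \<eta>) proj = \<mu> \<Otimes>\<^sub>M \<eta>"
      using pair_measure_distr[of fst "\<mu> \<Otimes>\<^sub>M \<mu>" \<mu> fst "\<eta> \<Otimes>\<^sub>M \<eta>" \<eta>]
      by (simp add: Q_def proj_def \<mu>.distr_pair_fst \<eta>.distr_pair_fst \<eta>.sigma_finite_measure_axioms)
    show "distr Q (\<mu> \<Otimes>\<^sub>M \<mu>) fst = \<mu> \<Otimes>\<^sub>M \<mu>"
      unfolding Q_def by (rule \<eta>2.distr_pair_fst)
    show "distr Q (\<eta> \<Otimes>\<^sub>M \<eta>) snd = \<eta> \<Otimes>\<^sub>M \<eta>"
      unfolding Q_def by (rule distr_pair_snd) unfold_locales
  qed
  have k_int: "integrable (\<mu> \<Otimes>\<^sub>M \<eta>) k" "integrable (\<mu> \<Otimes>\<^sub>M \<mu>) k" "integrable (\<eta> \<Otimes>\<^sub>M \<eta>) k"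
    unfolding k_def[abs_def] by (intro integrable_dist_powr; fact)+
  then have int: "integrable Q (\<lambda>z. k (proj z))" "integrable Q (\<lambda>z. k (fst z))"
    "integrable Q (\<lambda>z. k (snd z))"
    using marginals integrable_distr_eq[of proj Q "\<mu> \<Otimes>\<^sub>M \<eta>" k]
      integrable_distr_eq[of fst Q "\<mu> \<Otimes>\<^sub>M \<mu>" k] integrable_distr_eq[of snd Q "\<eta> \<Otimes>\<^sub>M \<eta>" k]
    by simp_all
  have "energy_dist_sq \<gamma> \<mu> \<eta> = (LINT z|Q. 2 * k (proj z) - k (fst z) - k (snd z))"
    by (simp add: energy_dist_sq_def Q_def k_def proj_def case_prod_beta')
  also have "\<dots> = 2 * (LINT z|Q. k (proj z)) - (LINT z|Q. k (fst z)) - (LINT z|Q. k (snd z))"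
    using int by simp
  also have "(LINT z|Q. k (proj z)) = mean_dist_powr \<gamma> \<mu> \<eta>"
    using integral_distr[of proj Q "\<mu> \<Otimes>\<^sub>M \<eta>" k] marginals
    by (simp add: mean_dist_powr_def k_def[abs_def])
  also have "(LINT z|Q. k (fst z)) = mean_dist_powr \<gamma> \<mu> \<mu>"
    using integral_distr[of fst Q "\<mu> \<Otimes>\<^sub>M \<mu>" k] marginals
    by (simp add: mean_dist_powr_def k_def[abs_def])
  also have "(LINT z|Q. k (snd z)) = mean_dist_powr \<gamma> \<eta> \<eta>"
    using integral_distr[of snd Q "\<eta> \<Otimes>\<^sub>M \<eta>" k] marginals
    by (simp add: mean_dist_powr_def k_def[abs_def])
  finally show ?thesis .
qed

section \<open>Integrals against the empirical measure\<close>

text \<open>Drawing an index uniformly counts coinciding sample points with their multiplicity.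
  Integrals thereby become finite averages over indices.\<close>

lemma empirical_measure_eq_distr:
  "empirical_measure n x = distr (uniform_count_measure {1..n}) borel x"
proof (rule measure_eqI)
  fix A assume "A \<in> sets (empirical_measure n x)"
  then have A: "A \<in> sets borel" by simp
  have "(\<Sum>i=1..n. emeasure (return borel (x i)) A) = (\<Sum>i=1..n. indicator A (x i))"
    using A by simp
  also have "\<dots> = of_nat (card {i \<in> {1..n}. x i \<in> A})"
    by (simp add: indicator_def sum.If_cases Int_def)
  also have "{i \<in> {1..n}. x i \<in> A} = x -` A \<inter> space (uniform_count_measure {1..n})"
    by (auto simp: space_uniform_count_measure)
  finally show "emeasure (empirical_measure n x) A =
      emeasure (distr (uniform_count_measure {1..n}) borel x) A"
    using A
    by (simp add: emeasure_empirical_measure emeasure_distr emeasure_uniform_count_measure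
        space_uniform_count_measure ennreal_of_nat_eq_real_of_nat divide_inverse mult.commute
        flip: ennreal_mult)
qed simp

lemma integral_empirical_measure:
  fixes f :: "'a::euclidean_space \<Rightarrow> real"
  assumes [measurable]: "f \<in> borel_measurable borel"
  shows "(LINT y|empirical_measure n x. f y) = (\<Sum>i=1..n. f (x i)) / real n"
    and "integrable (empirical_measure n x) f"
  by (simp_all add: empirical_measure_eq_distr integral_distr integrable_distr_eq
      uniform_count_measure_def lebesgue_integral_point_measure_finite
      integrable_point_measure_finite sum_divide_distrib)

text \<open>Fubini's theorem and finite averages evaluate the two mean distances that involve the
  sample. The double sum keeps its diagonal, the source of the \<open>1 / n\<close> bias.\<close>

lemma energy_dist_sq_empirical:
  fixes \<nu> :: "'a::euclidean_space measure"
  assumes "prob_space \<nu>" and [measurable_cong]: "sets \<nu> = sets borel"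
    and "finite_abs_moment \<gamma> \<nu>" and "0 \<le> \<gamma>" and "0 < n"
  shows "energy_dist_sq \<gamma> \<nu> (empirical_measure n x) =
    2 * ((\<Sum>i=1..n. LINT y|\<nu>. norm (y - x i) powr \<gamma>) / real n) - mean_dist_powr \<gamma> \<nu> \<nu>
      - (\<Sum>i=1..n. \<Sum>j=1..n. norm (x j - x i) powr \<gamma>) / (real n)\<^sup>2"
proof -
  let ?\<eta> = "empirical_measure n x"
  interpret \<nu>: prob_space \<nu> by fact
  interpret \<eta>: prob_space ?\<eta> using assms(5) by (rule prob_space_empirical_measure)
  interpret \<nu>\<eta>: pair_sigma_finite \<nu> ?\<eta> ..
  interpret \<eta>\<eta>: pair_sigma_finite ?\<eta> ?\<eta> ..
  have fin: "finite_abs_moment \<gamma> ?\<eta>"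
    unfolding finite_abs_moment_def by (rule integral_empirical_measure) measurable
  have "mean_dist_powr \<gamma> \<nu> ?\<eta> = (LINT z|?\<eta>. LINT y|\<nu>. norm (y - z) powr \<gamma>)"
    using integrable_dist_powr[OF \<nu>.prob_space_axioms assms(2) \<eta>.prob_space_axioms _ assms(3) fin assms(4)]
    by (subst \<nu>\<eta>.integral_snd) (simp_all add: mean_dist_powr_def case_prod_beta')
  also have "\<dots> = (\<Sum>i=1..n. LINT y|\<nu>. norm (y - x i) powr \<gamma>) / real n"
    by (rule integral_empirical_measure) measurable
  finally have 1: "mean_dist_powr \<gamma> \<nu> ?\<eta> = \<dots>" .
  have "mean_dist_powr \<gamma> ?\<eta> ?\<eta> = (LINT z|?\<eta>. LINT y|?\<eta>. norm (y - z) powr \<gamma>)"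
    using integrable_dist_powr[OF \<eta>.prob_space_axioms _ \<eta>.prob_space_axioms _ fin fin assms(4)]
    by (subst \<eta>\<eta>.integral_snd) (simp_all add: mean_dist_powr_def case_prod_beta')
  also have "\<dots> = (\<Sum>i=1..n. \<Sum>j=1..n. norm (x j - x i) powr \<gamma>) / (real n)\<^sup>2"
    by (subst sum.swap) (simp add: integral_empirical_measure sum_divide_distrib power2_eq_square)
  finally have 2: "mean_dist_powr \<gamma> ?\<eta> ?\<eta> = \<dots>" .
  show ?thesis
    using energy_dist_sq_eq[OF assms(1,2) \<eta>.prob_space_axioms _ assms(3) fin assms(4)]
    by (simp only: 1 2 sets_empirical_measure)
qed

section \<open>The moment bound and the expectation over the sample\<close>

text \<open>Real-valued form of \<open>nn_integral_dist_powr_le\<close>: the finite moment makes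
  both sides finite, so they agree with Bochner integrals.\<close>

lemma mean_dist_powr_le_abs_moment:
  fixes \<nu> :: "'a::euclidean_space measure"
  assumes "prob_space \<nu>" and [measurable_cong]: "sets \<nu> = sets borel"
    and "finite_abs_moment \<gamma> \<nu>" and "0 < \<gamma>" and "\<gamma> < 2"
  shows "mean_dist_powr \<gamma> \<nu> \<nu> \<le> 2 * abs_moment \<gamma> \<nu>"
proof -
  interpret prob_space \<nu> by fact
  have "ennreal (mean_dist_powr \<gamma> \<nu> \<nu>) = (\<integral>\<^sup>+z. ennreal (norm (fst z - snd z) powr \<gamma>) \<partial>(\<nu> \<Otimes>\<^sub>M \<nu>))"
    unfolding mean_dist_powr_def using assms
    by (subst nn_integral_eq_integral) (auto intro: integrable_dist_powr)
  also have "\<dots> = (\<integral>\<^sup>+x. \<integral>\<^sup>+y. ennreal (norm (x - y) powr \<gamma>) \<partial>\<nu> \<partial>\<nu>)"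
    using nn_integral_fst[of "\<lambda>z :: 'a \<times> 'a. ennreal (norm (fst z - snd z) powr \<gamma>)" \<nu>] by simp
  also have "\<dots> \<le> 2 * (\<integral>\<^sup>+x. ennreal (norm x powr \<gamma>) \<partial>\<nu>)"
    using assms by (intro nn_integral_dist_powr_le)
  also have "(\<integral>\<^sup>+x. ennreal (norm x powr \<gamma>) \<partial>\<nu>) = ennreal (abs_moment \<gamma> \<nu>)"
    using assms(3) by (simp add: nn_integral_eq_integral abs_moment_def finite_abs_moment_def)
  also have "2 * ennreal (abs_moment \<gamma> \<nu>) = ennreal (2 * abs_moment \<gamma> \<nu>)"
    by (simp add: ennreal_mult')
  finally show ?thesis
    by (simp add: ennreal_le_iff abs_moment_def)
qed

text \<open>Restrictions of the family to disjoint index sets are independent; here the sets are the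
  singletons of \<open>i\<close> and \<open>j\<close>. It identifies the joint law of two different
  sample points as a product.\<close>

lemma (in prob_space) indep_vars_imp_indep_var:
  assumes "indep_vars (\<lambda>_. N) X I" and "i \<in> I" and "j \<in> I" and "i \<noteq> j"
  shows "indep_var N (X i) N (X j)"
proof -
  have "indep_var N ((\<lambda>f. f i) \<circ> (\<lambda>\<omega>. restrict (\<lambda>i. X i \<omega>) {i}))
      N ((\<lambda>f. f j) \<circ> (\<lambda>\<omega>. restrict (\<lambda>i. X i \<omega>) {j}))"
    using assms by (intro indep_var_compose[OF indep_var_restrict[OF assms(1)]]) auto
  then show ?thesis by (simp add: comp_def)
qed

theorem lemma1:
  fixes \<gamma> :: real and n :: nat
    and \<nu> :: "(real ^ 'd) measure"
    and P :: "'w measure" and X :: "nat \<Rightarrow> 'w \<Rightarrow> real ^ 'd"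
  assumes "0 < \<gamma>" and "\<gamma> < 2"
    and "prob_space \<nu>" and "sets \<nu> = sets borel"
    and "finite_abs_moment \<gamma> \<nu>"
    and "0 < n"
    and "prob_space P"
    and "prob_space.indep_vars P (\<lambda>_. borel) X {1..n}"
    and "\<And>i. i \<in> {1..n} \<Longrightarrow> distr P borel (X i) = \<nu>"
  shows "integrable P (\<lambda>\<omega>. energy_dist_sq \<gamma> \<nu> (empirical_measure n (\<lambda>i. X i \<omega>)))
       \<and> prob_space.expectation P
           (\<lambda>\<omega>. energy_dist_sq \<gamma> \<nu> (empirical_measure n (\<lambda>i. X i \<omega>)))
         \<le> 2 * abs_moment \<gamma> \<nu> / real n"
proof -
  interpret P: prob_space P by fact
  interpret \<nu>: prob_space \<nu> by fact
  interpret pair_sigma_finite \<nu> \<nu> ..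
  note [measurable_cong] = assms(4)
  let ?D = "mean_dist_powr \<gamma> \<nu> \<nu>"
  let ?k = "\<lambda>z :: (real ^ 'd) \<times> (real ^ 'd). norm (fst z - snd z) powr \<gamma>"
  \<comment> \<open>The conditional mean of the cross term given the sample point \<open>z\<close>;
    averaging it over \<nu> gives \<open>?D\<close>.\<close>
  define g where "g z = (LINT y|\<nu>. norm (y - z) powr \<gamma>)" for z
  have [measurable]: "g \<in> borel_measurable borel"
    unfolding g_def[abs_def] by measurable
  have rv: "X i \<in> measurable P borel" if "i \<in> {1..n}" for i
    using assms(8) that by (auto simp: P.indep_vars_def)
  have k_int: "integrable (\<nu> \<Otimes>\<^sub>M \<nu>) ?k"
    using assms by (intro integrable_dist_powr) auto
  have g_int: "integrable \<nu> g"
    unfolding g_def[abs_def] by (rule integrable_snd) (use k_int in \<open>simp add: case_prod_beta'\<close>)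
  have g_eq: "(LINT z|\<nu>. g z) = ?D"
    unfolding g_def[abs_def] mean_dist_powr_def
    by (subst integral_snd) (use k_int in \<open>simp_all add: case_prod_beta'\<close>)
  have single: "integrable P (\<lambda>\<omega>. g (X i \<omega>))" "(LINT \<omega>|P. g (X i \<omega>)) = ?D"
    if i: "i \<in> {1..n}" for i
    using integrable_distr_eq[of "X i" P borel g] integral_distr[of "X i" P borel g]
      rv[OF i] assms(9)[OF i] g_int g_eq by simp_all
  \<comment> \<open>Independence gives \<open>?D\<close> off the diagonal; on it the distance is 0,
    and so is its power.\<close>
  have pair: "integrable P (\<lambda>\<omega>. norm (X j \<omega> - X i \<omega>) powr \<gamma>) \<and>
      (LINT \<omega>|P. norm (X j \<omega> - X i \<omega>) powr \<gamma>) = (if i = j then 0 else ?D)"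
    if i: "i \<in> {1..n}" and j: "j \<in> {1..n}" for i j
  proof (cases "i = j")
    case False
    then have "P.indep_var borel (X j) borel (X i)"
      using assms(8) i j by (intro P.indep_vars_imp_indep_var) auto
    then have d: "distr P (borel \<Otimes>\<^sub>M borel) (\<lambda>\<omega>. (X j \<omega>, X i \<omega>)) = \<nu> \<Otimes>\<^sub>M \<nu>"
      using assms(9) i j by (simp add: P.indep_var_distribution_eq)
    have m: "(\<lambda>\<omega>. (X j \<omega>, X i \<omega>)) \<in> measurable P (borel \<Otimes>\<^sub>M borel)"
      using rv i j by (intro measurable_Pair)
    have "?k \<in> borel_measurable (borel \<Otimes>\<^sub>M borel)" by measurable
    then show ?thesis
      using integrable_distr_eq[OF m, of ?k] integral_distr[OF m, of ?k] k_int False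
      by (simp add: d mean_dist_powr_def)
  qed simp
  have card: "(\<Sum>i=1..n. \<Sum>j=1..n. if i = j then 0 else ?D) = (real n)\<^sup>2 * ?D - real n * ?D"
  proof -
    have "(\<Sum>j=1..n. if i = j then 0 else ?D) = real n * ?D - ?D" if "i \<in> {1..n}" for i
    proof -
      have "(\<Sum>j=1..n. if i = j then 0 else ?D) = (\<Sum>j=1..n. ?D - (if i = j then ?D else 0))"
        by (intro sum.cong) auto
      then show ?thesis using that by (simp add: sum_subtractf)
    qed
    then have "(\<Sum>i=1..n. \<Sum>j=1..n. if i = j then 0 else ?D) = (\<Sum>i=1..n. real n * ?D - ?D)"
      by (rule sum.cong[OF refl])
    then show ?thesis by (simp add: power2_eq_square algebra_simps)
  qed
  let ?E = "\<lambda>\<omega>. energy_dist_sq \<gamma> \<nu> (empirical_measure n (\<lambda>i. X i \<omega>))"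
  \<comment> \<open>The empirical measure itself varies with \<omega>; this form reduces
    integrability in \<omega> to that of finite sums of functions of the sample.\<close>
  have E: "?E = (\<lambda>\<omega>. 2 * ((\<Sum>i=1..n. g (X i \<omega>)) / real n) - ?D
      - (\<Sum>i=1..n. \<Sum>j=1..n. norm (X j \<omega> - X i \<omega>) powr \<gamma>) / (real n)\<^sup>2)"
    using assms by (simp add: energy_dist_sq_empirical g_def)
  have sums: "integrable P (\<lambda>\<omega>. \<Sum>i=1..n. g (X i \<omega>))"
    "integrable P (\<lambda>\<omega>. \<Sum>i=1..n. \<Sum>j=1..n. norm (X j \<omega> - X i \<omega>) powr \<gamma>)"
    using single pair by (auto intro!: Bochner_Integration.integrable_sum)
  then have "integrable P ?E"
    unfolding E by simp
  have "(LINT \<omega>|P. (\<Sum>i=1..n. \<Sum>j=1..n. norm (X j \<omega> - X i \<omega>) powr \<gamma>)) =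
      (\<Sum>i=1..n. \<Sum>j=1..n. (LINT \<omega>|P. norm (X j \<omega> - X i \<omega>) powr \<gamma>))"
    using pair
    by (subst Bochner_Integration.integral_sum; (intro sum.cong refl Bochner_Integration.integral_sum)?)
       (auto intro!: Bochner_Integration.integrable_sum)
  also have "\<dots> = (\<Sum>i=1..n. \<Sum>j=1..n. if i = j then 0 else ?D)"
    by (intro sum.cong refl) (simp add: pair)
  finally have double:
    "(LINT \<omega>|P. (\<Sum>i=1..n. \<Sum>j=1..n. norm (X j \<omega> - X i \<omega>) powr \<gamma>)) = \<dots>" .
  have "P.expectation ?E = 2 * ((\<Sum>i=1..n. ?D) / real n) - ?D
      - (\<Sum>i=1..n. \<Sum>j=1..n. if i = j then 0 else ?D) / (real n)\<^sup>2"
    unfolding E using sums single double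
    by (simp add: Bochner_Integration.integral_sum P.prob_space)
  \<comment> \<open>The cross term gives \<open>2 * ?D\<close>, and the \<open>n * (n - 1)\<close>
    off-diagonal pairs give \<open>(1 - 1 / n) * ?D\<close>, so only \<open>?D / n\<close> is
    left.\<close>
  also have "\<dots> = ?D / real n"
    unfolding card using assms(6) by (simp add: power2_eq_square field_simps)
  also have "\<dots> \<le> 2 * abs_moment \<gamma> \<nu> / real n"
    using mean_dist_powr_le_abs_moment[OF assms(3-5,1,2)] by (simp add: divide_right_mono)
  finally show ?thesis
    using \<open>integrable P ?E\<close> by simp
qed

end
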